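(* Let $(X,\rho)$ be a (pseudo)metric space, $m$ a measure on $X$, $x_0\in X$ arbitrary, $\omega(x)=\rho(x_0,x)$ and $B_r:=\{x\in X:\rho(x_0,x)\le r\}$. Let $u:X\to\mathbb{C}$ be subexponentially bounded. Define $J:[0,\infty)\to[0,\infty)$ by $J(r):=\int_{B_r}|u|^2\,dm$. Then $J$ is subexponentially bounded.
   Context: A function $u$ on $X$ is subexponentially bounded if $e^{-\alpha\omega}u\in L^2(X,m)$ for every $\alpha>0$, where $\omega(x)=\rho(x_0,x)$ for some $x_0\in X$ (the condition does not depend on the choice of $x_0$, since $\rho$ is finite). A function $J:[0,\infty)\to[0,\infty)$ is subexponentially bounded if for every $\alpha>0$ there exists $C_\alpha\ge0$ with $J(r)\le C_\alpha\exp(\alpha r)$ for all $r>0$. Balls are assumed measurable with respect to $m$. *)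

theory Defs
  imports "HOL-Analysis.Analysis"
begin

(* As the library locale Metric_space, but without separation of points. *)
locale Pseudometric_space =
  fixes X :: "'a set" and \<rho> :: "'a \<Rightarrow> 'a \<Rightarrow> real"
  assumes nonneg: "\<And>x y. x \<in> X \<Longrightarrow> y \<in> X \<Longrightarrow> 0 \<le> \<rho> x y"
    and refl_zero: "\<And>x. x \<in> X \<Longrightarrow> \<rho> x x = 0"
    and commute: "\<And>x y. x \<in> X \<Longrightarrow> y \<in> X \<Longrightarrow> \<rho> x y = \<rho> y x"
    and triangle: "\<And>x y z. x \<in> X \<Longrightarrow> y \<in> X \<Longrightarrow> z \<in> X \<Longrightarrow> \<rho> x z \<le> \<rho> x y + \<rho> y z"

definition pball :: "'a set \<Rightarrow> ('a \<Rightarrow> 'a \<Rightarrow> real) \<Rightarrow> 'a \<Rightarrow> real \<Rightarrow> 'a set" where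
  "pball X \<rho> x\<^sub>0 r = {x \<in> X. \<rho> x\<^sub>0 x \<le> r}"

(* Functions rather than classes modulo null sets; only the values on space m matter. *)
definition L2 :: "'a measure \<Rightarrow> ('a \<Rightarrow> complex) set" where
  "L2 m = {f \<in> borel_measurable m. integrable m (\<lambda>x. (cmod (f x))\<^sup>2)}"

definition subexp_bounded_on ::
  "'a set \<Rightarrow> ('a \<Rightarrow> 'a \<Rightarrow> real) \<Rightarrow> 'a measure \<Rightarrow> ('a \<Rightarrow> complex) \<Rightarrow> bool" where
  "subexp_bounded_on X \<rho> m u \<longleftrightarrow>
     (\<exists>x\<^sub>0\<in>X. \<forall>\<alpha>>0. (\<lambda>x. complex_of_real (exp (- \<alpha> * \<rho> x\<^sub>0 x)) * u x) \<in> L2 m)"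

(* A function on [0, \<infinity>) is represented by a function on the reals of which only
   the values at nonnegative arguments are used. *)
definition subexp_bounded_fun :: "(real \<Rightarrow> real) \<Rightarrow> bool" where
  "subexp_bounded_fun J \<longleftrightarrow>
     J \<in> {0..} \<rightarrow> {0..} \<and> (\<forall>\<alpha>>0. \<exists>C\<ge>0. \<forall>r>0. J r \<le> C * exp (\<alpha> * r))"

end

theory Submission
  imports Defs
begin

text \<open>On the ball of radius \<open>r\<close> about \<open>x\<^sub>0\<close> the triangle inequality bounds the distance to any
  other base point \<open>y\<close> by \<open>\<rho> y x\<^sub>0 + r\<close>, so there \<open>|u|\<^sup>2\<close> is at most
  \<open>exp (2\<alpha> (\<rho> y x\<^sub>0 + r)) |exp (- \<alpha> \<rho> y) u|\<^sup>2\<close>; integrate and take \<open>\<alpha>\<close> to be half of the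
  required growth rate.\<close>

text \<open>The sublevel sets of \<open>\<rho> y\<close> are exactly the closed balls about
  \<open>y\<close>.\<close>

lemma borel_measurable_pseudodist:
  assumes "space m = X" and "\<And>r. pball X \<rho> y r \<in> sets m"
  shows "\<rho> y \<in> borel_measurable m"
  using assms by (simp add: borel_measurable_iff_le pball_def)

text \<open>An exponential weight never vanishes, so it can be divided out again. This recovers
  measurability of \<open>u\<close>, since membership in \<open>L2\<close> speaks of the weighted
  function only.\<close>

lemma borel_measurable_of_weighted:
  fixes u :: "'a \<Rightarrow> complex" and g :: "'a \<Rightarrow> real"
  assumes g: "g \<in> borel_measurable m"
    and f: "(\<lambda>x. complex_of_real (exp (g x)) * u x) \<in> borel_measurable m"
  shows "u \<in> borel_measurable m"
proof -
  have "(\<lambda>x. complex_of_real (exp (- g x)) * (complex_of_real (exp (g x)) * u x))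
      \<in> borel_measurable m"
    using g f by measurable
  then show ?thesis
    by (simp add: exp_minus mult.assoc [symmetric])
qed

context Pseudometric_space
begin

lemma norm_le_weighted_on_pball:
  fixes u :: "'a \<Rightarrow> complex"
  assumes "y \<in> X" "x\<^sub>0 \<in> X" "x \<in> pball X \<rho> x\<^sub>0 r" "0 \<le> \<alpha>"
  shows "(cmod (u x))\<^sup>2 \<le> exp (2 * \<alpha> * (\<rho> y x\<^sub>0 + r)) *
    (cmod (complex_of_real (exp (- \<alpha> * \<rho> y x)) * u x))\<^sup>2"
proof -
  have "\<rho> y x \<le> \<rho> y x\<^sub>0 + r"
    using assms triangle [of y x\<^sub>0 x] by (auto simp: pball_def)
  then have "1 \<le> exp (2 * \<alpha> * (\<rho> y x\<^sub>0 + r - \<rho> y x))"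
    using \<open>0 \<le> \<alpha>\<close> by simp
  then have "1 * (cmod (u x))\<^sup>2 \<le> exp (2 * \<alpha> * (\<rho> y x\<^sub>0 + r - \<rho> y x)) * (cmod (u x))\<^sup>2"
    by (rule mult_right_mono) simp
  \<comment> \<open>Split the exponent: the part depending on \<open>x\<close> is the squared
    weight, the rest is constant on the ball.\<close>
  also have "exp (2 * \<alpha> * (\<rho> y x\<^sub>0 + r - \<rho> y x)) =
      exp (2 * \<alpha> * (\<rho> y x\<^sub>0 + r)) * (exp (- \<alpha> * \<rho> y x))\<^sup>2"
    by (simp add: exp_double [symmetric] exp_add [symmetric] right_diff_distrib)
  finally show ?thesis
    by (simp add: norm_mult power_mult_distrib mult.assoc)
qed

text \<open>Integrates the pointwise bound, with the integral over the whole space as majorant.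
  Integrability is recorded separately because the integral of a non-integrable function is 0 by
  convention, which would make the second claim hold trivially.\<close>

lemma weighted_L2_bound_on_pball:
  fixes u :: "'a \<Rightarrow> complex"
  assumes space: "space m = X" and balls: "\<And>x r. x \<in> X \<Longrightarrow> pball X \<rho> x r \<in> sets m"
    and y: "y \<in> X" and x0: "x\<^sub>0 \<in> X" and "0 \<le> \<alpha>"
    and L2: "(\<lambda>x. complex_of_real (exp (- \<alpha> * \<rho> y x)) * u x) \<in> L2 m"
  shows "set_integrable m (pball X \<rho> x\<^sub>0 r) (\<lambda>x. (cmod (u x))\<^sup>2)"
    and "(LINT x:pball X \<rho> x\<^sub>0 r|m. (cmod (u x))\<^sup>2) \<le> exp (2 * \<alpha> * (\<rho> y x\<^sub>0 + r)) *
      (LINT x|m. (cmod (complex_of_real (exp (- \<alpha> * \<rho> y x)) * u x))\<^sup>2)"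
proof -
  let ?w = "\<lambda>x. (cmod (complex_of_real (exp (- \<alpha> * \<rho> y x)) * u x))\<^sup>2"
  let ?c = "exp (2 * \<alpha> * (\<rho> y x\<^sub>0 + r))"
  let ?f = "\<lambda>x. indicat_real (pball X \<rho> x\<^sub>0 r) x *\<^sub>R (cmod (u x))\<^sup>2"
  have "\<rho> y \<in> borel_measurable m"
    using space balls [OF y] by (rule borel_measurable_pseudodist)
  then have "(\<lambda>x. - \<alpha> * \<rho> y x) \<in> borel_measurable m"
    by (intro borel_measurable_times borel_measurable_const)
  moreover have "(\<lambda>x. complex_of_real (exp (- \<alpha> * \<rho> y x)) * u x) \<in> borel_measurable m"
    using L2 unfolding L2_def by blast
  ultimately have u[measurable]: "u \<in> borel_measurable m"
    by (rule borel_measurable_of_weighted)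
  have [measurable]: "pball X \<rho> x\<^sub>0 r \<in> sets m"
    using balls [OF x0] .
  have w: "integrable m (\<lambda>x. ?c * ?w x)"
    using L2 unfolding L2_def by (intro integrable_mult_right) blast
  \<comment> \<open>Off the ball the left side is 0 and the right side is nonnegative, so the bound
    holds everywhere.\<close>
  have le: "?f x \<le> ?c * ?w x" for x
    using norm_le_weighted_on_pball [OF y x0 _ \<open>0 \<le> \<alpha>\<close>, of x r u]
    by (cases "x \<in> pball X \<rho> x\<^sub>0 r") simp_all
  have f: "integrable m ?f"
  proof (rule Bochner_Integration.integrable_bound [OF w])
    show "AE x in m. norm (?f x) \<le> norm (?c * ?w x)"
      using le by (intro AE_I2) (simp add: abs_mult)
  qed measurable
  then show "set_integrable m (pball X \<rho> x\<^sub>0 r) (\<lambda>x. (cmod (u x))\<^sup>2)"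
    by (simp add: set_integrable_def)
  have "integral\<^sup>L m ?f \<le> (LINT x|m. ?c * ?w x)"
    using f w le by (rule integral_mono)
  then show "(LINT x:pball X \<rho> x\<^sub>0 r|m. (cmod (u x))\<^sup>2) \<le> ?c * (LINT x|m. ?w x)"
    by (simp add: set_lebesgue_integral_def)
qed

end

theorem lemma4p3:
  fixes X :: "'a set" and \<rho> :: "'a \<Rightarrow> 'a \<Rightarrow> real" and m :: "'a measure"
    and x\<^sub>0 :: 'a and u :: "'a \<Rightarrow> complex" and J :: "real \<Rightarrow> real"
  assumes "Pseudometric_space X \<rho>"
    and "space m = X"
    and "\<And>x r. x \<in> X \<Longrightarrow> pball X \<rho> x r \<in> sets m"
    and "x\<^sub>0 \<in> X"
    and "subexp_bounded_on X \<rho> m u"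
    and "\<And>r. 0 \<le> r \<Longrightarrow> J r = (LINT x:pball X \<rho> x\<^sub>0 r|m. (cmod (u x))\<^sup>2)"
  shows "(\<forall>r\<ge>0. set_integrable m (pball X \<rho> x\<^sub>0 r) (\<lambda>x. (cmod (u x))\<^sup>2))
       \<and> subexp_bounded_fun J"
proof -
  interpret Pseudometric_space X \<rho>
    by fact
  \<comment> \<open>The base point \<open>y\<close> of the weight may differ from the centre
    \<open>x\<^sub>0\<close> of the balls.\<close>
  obtain y where y: "y \<in> X"
    and L2: "\<And>\<alpha>. 0 < \<alpha> \<Longrightarrow> (\<lambda>x. complex_of_real (exp (- \<alpha> * \<rho> y x)) * u x) \<in> L2 m"
    using assms(5) unfolding subexp_bounded_on_def by blast
  note bound = weighted_L2_bound_on_pball [OF assms(2,3) y assms(4) less_imp_le L2]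
  \<comment> \<open>Any single positive rate gives integrability on every ball; 1 is an arbitrary
    choice.\<close>
  have "set_integrable m (pball X \<rho> x\<^sub>0 r) (\<lambda>x. (cmod (u x))\<^sup>2)" for r
    by (rule bound(1) [of 1]) simp_all
  moreover have "J \<in> {0..} \<rightarrow> {0..}"
    by (auto simp: assms(6) set_lebesgue_integral_def)
  moreover have "\<exists>C\<ge>0. \<forall>r>0. J r \<le> C * exp (\<alpha> * r)" if "0 < \<alpha>" for \<alpha>
  proof -
    let ?I = "LINT x|m. (cmod (complex_of_real (exp (- (\<alpha> / 2) * \<rho> y x)) * u x))\<^sup>2"
    \<comment> \<open>The bracket is the witness for \<open>C\<close>: it depends on \<alpha> but
      not on \<open>r\<close>, and its exponential factor is the cost of moving the base point from
      \<open>y\<close> to \<open>x\<^sub>0\<close>.\<close>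
    have "J r \<le> (exp (\<alpha> * \<rho> y x\<^sub>0) * ?I) * exp (\<alpha> * r)" if "0 < r" for r
    proof -
      have "J r \<le> exp (2 * (\<alpha> / 2) * (\<rho> y x\<^sub>0 + r)) * ?I"
        using bound(2) [of "\<alpha> / 2" r] \<open>0 < \<alpha>\<close> \<open>0 < r\<close> by (simp add: assms(6))
      also have "\<dots> = (exp (\<alpha> * \<rho> y x\<^sub>0) * ?I) * exp (\<alpha> * r)"
        by (simp add: distrib_left exp_add)
      finally show ?thesis .
    qed
    moreover have "0 \<le> exp (\<alpha> * \<rho> y x\<^sub>0) * ?I"
      by simp
    ultimately show ?thesis
      by blast
  qed
  ultimately show ?thesis
    by (simp add: subexp_bounded_fun_def)
qed

end
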